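(* Let $L$ be a frame and let $X$ be its Priestley space of prime filters. Then $L$ is completely regular if and only if $\mathrm{cl}(\mathrm{creg}\, U) = U$ for each $U \in \mathrm{ClopUp}(X)$.
   Context: A frame is a complete lattice satisfying $a \wedge \bigvee S = \bigvee\{a \wedge s \mid s \in S\}$. The Priestley space of a frame $L$ is the set $X$ of (proper) prime filters of $L$ ordered by inclusion, with topology generated by the basis $\{\sigma(a) \cap \sigma(b)^c \mid a,b \in L\}$, where $\sigma(a) = \{x \in X \mid a \in x\}$. The axiom of choice is assumed. $\mathrm{ClopUp}(X)$ is the set of clopen upsets of $X$, which, ordered by inclusion, is a frame isomorphic to $L$ via $\sigma$; $\mathrm{cl}$ is topological closure in $X$. In a frame, $a^*$ denotes the pseudocomplement of $a$, and $a \prec b$ ($a$ is rather below $b$) means $a^* \vee b = 1$. A scale from $a$ to $b$ is a family $\{a_r \mid r \in \mathbb{Q} \cap [0,1]\}$ of elements such that $a = a_0 \le a_r \prec a_s \le a_1 = b$ for all $r < s$ in $\mathbb{Q} \cap [0,1]$. We say $a$ is completely below $b$ if there is a scale from $a$ to $b$. A frame $L$ is completely regular if for all $a,b \in L$ with $a \nleq b$ there is $c \in L$ such that $c$ is completely below $a$ and $c \nleq b$ (equivalently, each $a$ is the join of the elements completely below it). For $U \in \mathrm{ClopUp}(X)$, a point $x$ is completely inside $U$ if there is a scale $\{U_r \mid r \in \mathbb{Q}\cap[0,1]\}$ in the frame $\mathrm{ClopUp}(X)$ with $U_1 = U$ and $x \in U_0$. The completely regular kernel of $U$ is $\mathrm{creg}\,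 U = \{x \in U \mid x \text{ is completely inside } U\}$. *)

theory Defs
  imports "HOL-Analysis.Analysis" "HOL-Algebra.Complete_Lattice"
begin

locale frame = complete_lattice +
  assumes meet_sup_distrib:
    "\<lbrakk>a \<in> carrier L; S \<subseteq> carrier L\<rbrakk> \<Longrightarrow> a \<sqinter> \<Squnion>S = \<Squnion>{a \<sqinter> s | s. s \<in> S}"

text \<open>The notions below take the ordered structure as an argument because they are applied both
  to the given frame and to its frame of clopen upsets.\<close>

definition pseudocomplement :: "('a, 'b) gorder_scheme \<Rightarrow> 'a \<Rightarrow> 'a" where
  "pseudocomplement L a = \<Squnion>\<^bsub>L\<^esub> {x \<in> carrier L. a \<sqinter>\<^bsub>L\<^esub> x = \<bottom>\<^bsub>L\<^esub>}"

definition rather_below :: "('a, 'b) gorder_scheme \<Rightarrow> 'a \<Rightarrow> 'a \<Rightarrow> bool" where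
  "rather_below L a b \<longleftrightarrow> pseudocomplement L a \<squnion>\<^bsub>L\<^esub> b = \<top>\<^bsub>L\<^esub>"

text \<open>Only the values of \<open>c\<close> at the rationals in \<open>[0,1]\<close> matter.\<close>

definition is_scale :: "('a, 'b) gorder_scheme \<Rightarrow> 'a \<Rightarrow> 'a \<Rightarrow> (rat \<Rightarrow> 'a) \<Rightarrow> bool" where
  "is_scale L a b c \<longleftrightarrow>
     (\<forall>r\<in>{0..1}. c r \<in> carrier L) \<and> c 0 = a \<and> c 1 = b \<and>
     (\<forall>r\<in>{0..1}. \<forall>s\<in>{0..1}. r < s \<longrightarrow>
        a \<sqsubseteq>\<^bsub>L\<^esub> c r \<and> rather_below L (c r) (c s) \<and> c s \<sqsubseteq>\<^bsub>L\<^esub> b)"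

definition completely_below :: "('a, 'b) gorder_scheme \<Rightarrow> 'a \<Rightarrow> 'a \<Rightarrow> bool" where
  "completely_below L a b \<longleftrightarrow> (\<exists>c. is_scale L a b c)"

definition completely_regular :: "('a, 'b) gorder_scheme \<Rightarrow> bool" where
  "completely_regular L \<longleftrightarrow>
     (\<forall>a\<in>carrier L. \<forall>b\<in>carrier L. \<not> a \<sqsubseteq>\<^bsub>L\<^esub> b \<longrightarrow>
        (\<exists>c\<in>carrier L. completely_below L c a \<and> \<not> c \<sqsubseteq>\<^bsub>L\<^esub> b))"

definition prime_filter :: "('a, 'b) gorder_scheme \<Rightarrow> 'a set \<Rightarrow> bool" where
  "prime_filter L x \<longleftrightarrow>
     x \<subseteq> carrier L \<and> x \<noteq> {} \<and> x \<noteq> carrier L \<and>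
     (\<forall>a\<in>x. \<forall>b\<in>carrier L. a \<sqsubseteq>\<^bsub>L\<^esub> b \<longrightarrow> b \<in> x) \<and>
     (\<forall>a\<in>x. \<forall>b\<in>x. a \<sqinter>\<^bsub>L\<^esub> b \<in> x) \<and>
     (\<forall>a\<in>carrier L. \<forall>b\<in>carrier L. a \<squnion>\<^bsub>L\<^esub> b \<in> x \<longrightarrow> a \<in> x \<or> b \<in> x)"

definition priestley_points :: "('a, 'b) gorder_scheme \<Rightarrow> 'a set set" where
  "priestley_points L = {x. prime_filter L x}"

definition sigma :: "('a, 'b) gorder_scheme \<Rightarrow> 'a \<Rightarrow> 'a set set" where
  "sigma L a = {x \<in> priestley_points L. a \<in> x}"

definition priestley_topology :: "('a, 'b) gorder_scheme \<Rightarrow> 'a set topology" where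
  "priestley_topology L =
     topology_generated_by
       {sigma L a \<inter> (priestley_points L - sigma L b) | a b. a \<in> carrier L \<and> b \<in> carrier L}"

definition clopen_upset :: "('a, 'b) gorder_scheme \<Rightarrow> 'a set set \<Rightarrow> bool" where
  "clopen_upset L U \<longleftrightarrow>
     openin (priestley_topology L) U \<and> closedin (priestley_topology L) U \<and>
     (\<forall>x\<in>U. \<forall>y\<in>priestley_points L. x \<subseteq> y \<longrightarrow> y \<in> U)"

definition ClopUp :: "('a, 'b) gorder_scheme \<Rightarrow> 'a set set gorder" where
  "ClopUp L = \<lparr>carrier = {U. clopen_upset L U}, eq = (=), le = (\<subseteq>)\<rparr>"

definition completely_inside ::
    "('a, 'b) gorder_scheme \<Rightarrow> 'a set \<Rightarrow> 'a set set \<Rightarrow> bool" where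
  "completely_inside L x U \<longleftrightarrow> (\<exists>V c. is_scale (ClopUp L) V U c \<and> x \<in> V)"

definition creg :: "('a, 'b) gorder_scheme \<Rightarrow> 'a set set \<Rightarrow> 'a set set" where
  "creg L U = {x \<in> U. completely_inside L x U}"

text \<open>The generated topology has the whole set of prime filters as its underlying space.\<close>

lemma (in frame) topspace_priestley_topology:
  "topspace (priestley_topology L) = priestley_points L"
proof -
  have "x \<in> sigma L \<top> \<inter> (priestley_points L - sigma L \<bottom>)" if "prime_filter L x" for x
  proof -
    have "\<top> \<in> x"
      using that top_closed top_higher unfolding prime_filter_def
      by (metis all_not_in_conv subsetD)
    moreover have "\<bottom> \<notin> x"
      using that bottom_lower unfolding prime_filter_def by (metis subsetI subset_antisym)
    ultimately show ?thesis
      using that by (simp add: sigma_def priestley_points_def)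
  qed
  then have "priestley_points L \<subseteq> sigma L \<top> \<inter> (priestley_points L - sigma L \<bottom>)"
    unfolding priestley_points_def by blast
  moreover have "sigma L \<top> \<inter> (priestley_points L - sigma L \<bottom>) \<in>
      {sigma L a \<inter> (priestley_points L - sigma L b) | a b. a \<in> carrier L \<and> b \<in> carrier L}"
    using top_closed bottom_closed by blast
  ultimately show ?thesis
    unfolding priestley_topology_def topology_generated_by_topspace by blast
qed

end

theory Submission
  imports Defs
begin

text \<open>
  Complete regularity asks that every failure \<open>\<not> a \<sqsubseteq> b\<close> be witnessed by some \<open>c\<close>
  completely below \<open>a\<close> with \<open>\<not> c \<sqsubseteq> b\<close>.  Density of the kernel asks that every
  basic open set \<open>\<sigma>(b) - \<sigma>(d)\<close> around a point of \<open>U\<close> meet \<open>creg U\<close>.  The two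
  conditions become the same one under three translations.

  \<^item> A basic open set \<open>\<sigma>(a) - \<sigma>(b)\<close> is nonempty exactly when \<open>\<not> a \<sqsubseteq> b\<close>
    (\<open>sigma_subset_iff\<close>, from the prime filter theorem \<open>prime_filter_separation\<close>).

  \<^item> The clopen upsets are exactly the sets \<open>\<sigma>(a)\<close> (\<open>carrier_ClopUp\<close>).  Every \<open>\<sigma>(a)\<close> is
    clopen by definition of the topology; conversely a clopen upset is obtained by two finite
    subcover arguments, one giving a meet and one giving a join, so compactness of the space
    (\<open>compact_priestley_space\<close>) is what makes this work.

  \<^item> Hence \<open>\<sigma>\<close> is an isomorphism of the frame with its clopen upsets.  Scales are defined from
    the order alone, so they correspond under \<open>\<sigma>\<close> (\<open>completely_below_iff\<close>), and
    \<open>creg \<sigma>(a)\<close> is the union of the sets \<open>\<sigma>(c)\<close> with \<open>c\<close> completely below \<open>a\<close>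
    (\<open>creg_sigma\<close>).

  If the frame is completely regular and \<open>x\<close> lies in \<open>\<sigma>(a)\<close> and in \<open>\<sigma>(b) - \<sigma>(d)\<close>,
  then the meet of \<open>a\<close> and \<open>b\<close> is not below \<open>d\<close>; some \<open>c\<close> completely below this
  meet is not below \<open>d\<close>, and any point of \<open>\<sigma>(c) - \<sigma>(d)\<close> is a point of the kernel
  inside the given neighbourhood.  Conversely, if \<open>\<not> a \<sqsubseteq> b\<close> then the nonempty open subset
  \<open>\<sigma>(a) - \<sigma>(b)\<close> of \<open>\<sigma>(a)\<close> contains a point of the kernel, and that point lies
  in some \<open>\<sigma>(c)\<close> with \<open>c\<close> completely below \<open>a\<close> and not below \<open>b\<close>.
\<close>

section \<open>Order isomorphisms\<close>

text \<open>Suprema and infima in \<open>M\<close> are choice terms, and the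
  bijection supplies both the existence and, through antisymmetry of \<open>M\<close>, the uniqueness that pin
  them down.\<close>

locale complete_lattice_iso = L?: complete_lattice L + M: partial_order M
  for L :: "('a, 'c) gorder_scheme" (structure) and M :: "('b, 'd) gorder_scheme" +
  fixes f :: "'a \<Rightarrow> 'b"
  assumes bij: "bij_betw f (carrier L) (carrier M)"
    and le_iff: "\<lbrakk>x \<in> carrier L; y \<in> carrier L\<rbrakk> \<Longrightarrow> f x \<sqsubseteq>\<^bsub>M\<^esub> f y \<longleftrightarrow> x \<sqsubseteq> y"
begin

lemma image_carrier: "f ` carrier L = carrier M"
  using bij by (rule bij_betw_imp_surj_on)

lemma f_closed: "x \<in> carrier L \<Longrightarrow> f x \<in> carrier M"
  using image_carrier by blast

lemma f_eq_iff: "\<lbrakk>x \<in> carrier L; y \<in> carrier L\<rbrakk> \<Longrightarrow> f x = f y \<longleftrightarrow> x = y"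
  using bij by (meson bij_betw_imp_inj_on inj_on_eq_iff)

lemma image_Upper:
  assumes A: "A \<subseteq> carrier L"
  shows "Upper M (f ` A) = f ` Upper L A"
proof -
  have "f x \<sqsubseteq>\<^bsub>M\<^esub> f u \<longleftrightarrow> x \<sqsubseteq> u" if "x \<in> A" "u \<in> carrier L" for x u
    using that A le_iff by blast
  then have iff: "f u \<in> Upper M (f ` A) \<longleftrightarrow> u \<in> Upper L A" if "u \<in> carrier L" for u
    using that A f_closed unfolding Upper_def by (auto simp: subset_iff)
  show ?thesis
  proof (intro subset_antisym subsetI)
    fix y
    assume y: "y \<in> Upper M (f ` A)"
    then have "y \<in> f ` carrier L"
      unfolding image_carrier Upper_def by blast
    then show "y \<in> f ` Upper L A"
      using y iff by blast
  next
    fix y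
    assume "y \<in> f ` Upper L A"
    then obtain u where "u \<in> Upper L A" "y = f u"
      by blast
    moreover from this have "u \<in> carrier L"
      unfolding Upper_def by blast
    ultimately show "y \<in> Upper M (f ` A)"
      using iff by blast
  qed
qed

lemma image_Lower:
  assumes A: "A \<subseteq> carrier L"
  shows "Lower M (f ` A) = f ` Lower L A"
proof -
  have "f u \<sqsubseteq>\<^bsub>M\<^esub> f x \<longleftrightarrow> u \<sqsubseteq> x" if "x \<in> A" "u \<in> carrier L" for x u
    using that A le_iff by blast
  then have iff: "f u \<in> Lower M (f ` A) \<longleftrightarrow> u \<in> Lower L A" if "u \<in> carrier L" for u
    using that A f_closed unfolding Lower_def by (auto simp: subset_iff)
  show ?thesis
  proof (intro subset_antisym subsetI)
    fix y
    assume y: "y \<in> Lower M (f ` A)"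
    then have "y \<in> f ` carrier L"
      unfolding image_carrier Lower_def by blast
    then show "y \<in> f ` Lower L A"
      using y iff by blast
  next
    fix y
    assume "y \<in> f ` Lower L A"
    then obtain u where "u \<in> Lower L A" "y = f u"
      by blast
    moreover from this have "u \<in> carrier L"
      unfolding Lower_def by blast
    ultimately show "y \<in> Lower M (f ` A)"
      using iff by blast
  qed
qed

lemma image_least: "least L x A \<Longrightarrow> least M (f x) (f ` A)"
  unfolding least_def image_carrier[symmetric] using le_iff by (auto simp: subset_iff)

lemma image_greatest: "greatest L x A \<Longrightarrow> greatest M (f x) (f ` A)"
  unfolding greatest_def image_carrier[symmetric] using le_iff by (auto simp: subset_iff)

lemma image_sup:
  assumes "A \<subseteq> carrier L"
  shows "\<Squnion>\<^bsub>M\<^esub> (f ` A) = f (\<Squnion> A)"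
proof -
  have "least L (\<Squnion> A) (Upper L A)"
    unfolding sup_def using L.sup_exists[OF assms] by (rule someI_ex)
  then have *: "least M (f (\<Squnion> A)) (Upper M (f ` A))"
    using image_least image_Upper[OF assms] by simp
  show ?thesis
    unfolding sup_def[of M] by (rule some_equality, rule *, rule M.least_unique[OF _ *])
qed

lemma image_inf:
  assumes "A \<subseteq> carrier L"
  shows "\<Sqinter>\<^bsub>M\<^esub> (f ` A) = f (\<Sqinter> A)"
proof -
  have "greatest L (\<Sqinter> A) (Lower L A)"
    unfolding inf_def using L.inf_exists[OF assms] by (rule someI_ex)
  then have *: "greatest M (f (\<Sqinter> A)) (Lower M (f ` A))"
    using image_greatest image_Lower[OF assms] by simp
  show ?thesis
    unfolding inf_def[of M] by (rule some_equality, rule *, rule M.greatest_unique[OF _ *])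
qed

lemma image_bottom: "\<bottom>\<^bsub>M\<^esub> = f \<bottom>"
proof -
  have *: "least M (f \<bottom>) (carrier M)"
    using image_least[OF bottom_least] image_carrier by simp
  show ?thesis
    unfolding bottom_def[of M] by (rule some_equality, rule *, rule M.least_unique[OF _ *])
qed

lemma image_top: "\<top>\<^bsub>M\<^esub> = f \<top>"
proof -
  have *: "greatest M (f \<top>) (carrier M)"
    using image_greatest[OF top_greatest] image_carrier by simp
  show ?thesis
    unfolding top_def[of M] by (rule some_equality, rule *, rule M.greatest_unique[OF _ *])
qed

lemma image_pseudocomplement:
  assumes a: "a \<in> carrier L"
  shows "pseudocomplement M (f a) = f (pseudocomplement L a)"
proof -
  have "f a \<sqinter>\<^bsub>M\<^esub> f x = \<bottom>\<^bsub>M\<^esub> \<longleftrightarrow> a \<sqinter> x = \<bottom>" if "x \<in> carrier L" for x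
    using image_inf[of "{a, x}"] a that f_eq_iff[of "a \<sqinter> x" \<bottom>]
    by (simp add: meet_def image_bottom)
  then have "{y \<in> carrier M. f a \<sqinter>\<^bsub>M\<^esub> y = \<bottom>\<^bsub>M\<^esub>} = f ` {x \<in> carrier L. a \<sqinter> x = \<bottom>}"
    unfolding image_carrier[symmetric] by blast
  then show ?thesis
    unfolding pseudocomplement_def by (simp add: image_sup)
qed

lemma rather_below_iff:
  assumes "a \<in> carrier L" "b \<in> carrier L"
  shows "rather_below M (f a) (f b) \<longleftrightarrow> rather_below L a b"
proof -
  have p: "pseudocomplement L a \<in> carrier L"
    unfolding pseudocomplement_def by (rule L.weak.sup_closed) blast
  have "pseudocomplement M (f a) \<squnion>\<^bsub>M\<^esub> f b = f (pseudocomplement L a \<squnion> b)"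
    using image_sup[of "{pseudocomplement L a, b}"] p assms
    by (simp add: join_def image_pseudocomplement)
  then show ?thesis
    unfolding rather_below_def using p assms by (simp add: image_top f_eq_iff)
qed

lemma is_scale_image_iff:
  assumes c: "\<And>r. r \<in> {0..1} \<Longrightarrow> c r \<in> carrier L" and d: "\<And>r. r \<in> {0..1} \<Longrightarrow> d r = f (c r)"
    and a: "a \<in> carrier L" and b: "b \<in> carrier L"
  shows "is_scale M (f a) (f b) d \<longleftrightarrow> is_scale L a b c"
proof -
  have "d 0 = f a \<longleftrightarrow> c 0 = a" "d 1 = f b \<longleftrightarrow> c 1 = b"
    using a b c d by (simp_all add: f_eq_iff)
  moreover have "(f a \<sqsubseteq>\<^bsub>M\<^esub> d r \<and> rather_below M (d r) (d s) \<and> d s \<sqsubseteq>\<^bsub>M\<^esub> f b) \<longleftrightarrow>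
      (a \<sqsubseteq> c r \<and> rather_below L (c r) (c s) \<and> c s \<sqsubseteq> b)"
    if "r \<in> {0..1}" "s \<in> {0..1}" for r s
    unfolding d[OF that(1)] d[OF that(2)]
    using c[OF that(1)] c[OF that(2)] a b by (simp add: le_iff rather_below_iff)
  moreover have "\<forall>r\<in>{0..1}. c r \<in> carrier L" "\<forall>r\<in>{0..1}. d r \<in> carrier M"
    using c d f_closed by simp_all
  ultimately show ?thesis
    unfolding is_scale_def by blast
qed

text \<open>A scale in \<open>M\<close> is pulled back value by value along the inverse of \<open>f\<close>.  The inverse is only
  meaningful at rationals in \<open>[0,1]\<close>, where the scale is known to take values in the carrier.\<close>

lemma completely_below_iff:
  assumes a: "a \<in> carrier L" and b: "b \<in> carrier L"
  shows "completely_below M (f a) (f b) \<longleftrightarrow> completely_below L a b"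
proof
  assume "completely_below M (f a) (f b)"
  then obtain d where d: "is_scale M (f a) (f b) d"
    unfolding completely_below_def by blast
  define c where "c = inv_into (carrier L) f \<circ> d"
  have "d r \<in> f ` carrier L" if "r \<in> {0..1}" for r
    using d that unfolding is_scale_def image_carrier by blast
  then have "c r \<in> carrier L" "d r = f (c r)" if "r \<in> {0..1}" for r
    using that unfolding c_def o_apply by (auto simp: inv_into_into f_inv_into_f)
  then have "is_scale L a b c"
    using is_scale_image_iff a b d by blast
  then show "completely_below L a b"
    unfolding completely_below_def by blast
next
  assume "completely_below L a b"
  then obtain c where c: "is_scale L a b c"
    unfolding completely_below_def by blast
  have "c r \<in> carrier L" if "r \<in> {0..1}" for r
    using c that unfolding is_scale_def by blast
  then have "is_scale M (f a) (f b) (\<lambda>r. f (c r))"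
    using is_scale_image_iff[of c "\<lambda>r. f (c r)"] a b c by blast
  then show "completely_below M (f a) (f b)"
    unfolding completely_below_def by blast
qed

end

section \<open>Distributivity and scales in a frame\<close>

context frame
begin

lemma meet_join_distrib:
  assumes "a \<in> carrier L" "b \<in> carrier L" "c \<in> carrier L"
  shows "a \<sqinter> (b \<squnion> c) = (a \<sqinter> b) \<squnion> (a \<sqinter> c)"
proof -
  have "{a \<sqinter> s | s. s \<in> {b, c}} = {a \<sqinter> b, a \<sqinter> c}"
    by blast
  then show ?thesis
    using meet_sup_distrib[of a "{b, c}"] assms by (simp add: join_def)
qed

lemma scale_le:
  assumes s: "is_scale L a b c" and b: "b \<in> carrier L"
  shows "a \<sqsubseteq> b"
proof -
  have carr: "c r \<in> carrier L" if "r \<in> {0..1}" for r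
    using s that unfolding is_scale_def by blast
  have between: "a \<sqsubseteq> c r" "c t \<sqsubseteq> b" if "r \<in> {0..1}" "t \<in> {0..1}" "r < t" for r t
    using s that unfolding is_scale_def by blast+
  \<comment> \<open>\<open>a\<close> and \<open>b\<close> are only compared with members of the scale, so pass through a middle one.\<close>
  have "a \<sqsubseteq> c (1/2)" "c (1/2) \<sqsubseteq> b"
    using between(1)[of "1/2" 1] between(2)[of 0 "1/2"] by simp_all
  moreover have "a \<in> carrier L" "c (1/2) \<in> carrier L"
    using carr[of 0] carr[of "1/2"] s unfolding is_scale_def by simp_all
  ultimately show ?thesis
    using b le_trans by blast
qed

lemma rather_below_mono:
  assumes "rather_below L a b" "b \<sqsubseteq> c" "b \<in> carrier L" "c \<in> carrier L"
  shows "rather_below L a c"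
proof -
  have p: "pseudocomplement L a \<in> carrier L"
    unfolding pseudocomplement_def by (rule weak.sup_closed) blast
  have "\<top> \<sqsubseteq> pseudocomplement L a \<squnion> c"
    using assms p unfolding rather_below_def
    by (metis join_closed join_le join_left join_right le_trans)
  then show ?thesis
    unfolding rather_below_def using p assms by (simp add: le_antisym)
qed

text \<open>Replacing only the top value of the scale suffices, because \<open>b\<close> occurs in the scale conditions
  either as an upper bound or on the right of the rather below relation.\<close>

lemma completely_below_mono:
  assumes "completely_below L a b" and bb': "b \<sqsubseteq> b'" and b: "b \<in> carrier L" "b' \<in> carrier L"
  shows "completely_below L a b'"
proof -
  obtain c where c: "is_scale L a b c"
    using assms unfolding completely_below_def by blast
  have "is_scale L a b' (c(1 := b'))"
    unfolding is_scale_def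
  proof (intro conjI ballI impI)
    fix r s :: rat
    assume r: "r \<in> {0..1}" and s: "s \<in> {0..1}" and rs: "r < s"
    then have r1: "r \<noteq> 1"
      by auto
    have *: "a \<sqsubseteq> c r" "rather_below L (c r) (c s)" "c s \<sqsubseteq> b" "c s \<in> carrier L" "c 1 = b"
      using c r s rs unfolding is_scale_def by blast+
    show "a \<sqsubseteq> (c(1 := b')) r"
      using * r1 by simp
    show "rather_below L ((c(1 := b')) r) ((c(1 := b')) s)"
      using * r1 rather_below_mono bb' b by auto
    show "(c(1 := b')) s \<sqsubseteq> b'"
      using le_trans[of "c s" b b'] * bb' b by simp
  qed (use c b in \<open>auto simp: is_scale_def\<close>)
  then show ?thesis
    unfolding completely_below_def by blast
qed

section \<open>Prime filters separate filters from ideals\<close>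

text \<open>Zorn's lemma gives a filter \<open>M\<close> that contains \<open>F\<close> and is maximal among those avoiding \<open>I\<close>.
  It is prime: if neither \<open>a\<close> nor \<open>b\<close> is in \<open>M\<close>, then some \<open>k\<close> in \<open>M\<close> has both its
  meet with \<open>a\<close> and its meet with \<open>b\<close> in \<open>I\<close>, so by distributivity its meet with
  \<open>a \<squnion> b\<close> is in \<open>I\<close> and therefore \<open>a \<squnion> b\<close> cannot be in \<open>M\<close>.\<close>

theorem prime_filter_separation:
  assumes F: "F \<subseteq> carrier L" "F \<noteq> {}"
      "\<And>a b. \<lbrakk>a \<in> F; b \<in> carrier L; a \<sqsubseteq> b\<rbrakk> \<Longrightarrow> b \<in> F"
      "\<And>a b. \<lbrakk>a \<in> F; b \<in> F\<rbrakk> \<Longrightarrow> a \<sqinter> b \<in> F"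
    and I: "I \<subseteq> carrier L" "I \<noteq> {}"
      "\<And>a b. \<lbrakk>b \<in> I; a \<in> carrier L; a \<sqsubseteq> b\<rbrakk> \<Longrightarrow> a \<in> I"
      "\<And>a b. \<lbrakk>a \<in> I; b \<in> I\<rbrakk> \<Longrightarrow> a \<squnion> b \<in> I"
    and disj: "F \<inter> I = {}"
  obtains x where "prime_filter L x" "F \<subseteq> x" "x \<inter> I = {}"
proof -
  define Fs where "Fs = {G. F \<subseteq> G \<and> G \<subseteq> carrier L \<and> G \<inter> I = {} \<and>
    (\<forall>a\<in>G. \<forall>b\<in>carrier L. a \<sqsubseteq> b \<longrightarrow> b \<in> G) \<and> (\<forall>a\<in>G. \<forall>b\<in>G. a \<sqinter> b \<in> G)}"
  have "\<exists>M\<in>Fs. \<forall>G\<in>Fs. M \<subseteq> G \<longrightarrow> G = M"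
  proof (rule subset_Zorn_nonempty)
    have "F \<in> Fs"
      unfolding Fs_def using F disj by blast
    then show "Fs \<noteq> {}"
      by blast
  next
    fix C
    assume ne: "C \<noteq> {}" and "subset.chain Fs C"
    then have sub: "C \<subseteq> Fs" and tot: "\<And>G H. \<lbrakk>G \<in> C; H \<in> C\<rbrakk> \<Longrightarrow> G \<subseteq> H \<or> H \<subseteq> G"
      unfolding subset_chain_def by blast+
    have "a \<sqinter> b \<in> \<Union>C" if ab: "a \<in> \<Union>C" "b \<in> \<Union>C" for a b
    proof -
      obtain G H where "G \<in> C" "H \<in> C" "a \<in> G" "b \<in> H"
        using ab by blast
      then obtain K where "K \<in> C" "a \<in> K" "b \<in> K"
        using tot by blast
      then show ?thesis
        using sub unfolding Fs_def by blast
    qed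
    moreover have "F \<subseteq> \<Union>C" "\<Union>C \<subseteq> carrier L" "\<Union>C \<inter> I = {}"
      "\<forall>a\<in>\<Union>C. \<forall>b\<in>carrier L. a \<sqsubseteq> b \<longrightarrow> b \<in> \<Union>C"
      using ne sub unfolding Fs_def by blast+
    ultimately show "\<Union>C \<in> Fs"
      unfolding Fs_def by blast
  qed
  then obtain M where "M \<in> Fs" and max: "\<And>G. \<lbrakk>G \<in> Fs; M \<subseteq> G\<rbrakk> \<Longrightarrow> G = M"
    by blast
  then have M: "F \<subseteq> M" "M \<subseteq> carrier L" "M \<inter> I = {}"
    and up: "\<And>a b. \<lbrakk>a \<in> M; b \<in> carrier L; a \<sqsubseteq> b\<rbrakk> \<Longrightarrow> b \<in> M"
    and meet: "\<And>a b. \<lbrakk>a \<in> M; b \<in> M\<rbrakk> \<Longrightarrow> a \<sqinter> b \<in> M"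
    unfolding Fs_def by blast+
  \<comment> \<open>Adjoining an element outside the maximal \<open>M\<close> generates a filter that reaches the ideal.\<close>
  have hit: "\<exists>m\<in>M. m \<sqinter> a \<in> I" if a: "a \<in> carrier L" "a \<notin> M" for a
  proof (rule ccontr)
    assume no: "\<not> ?thesis"
    define G where "G = {z \<in> carrier L. \<exists>m\<in>M. m \<sqinter> a \<sqsubseteq> z}"
    have MG: "M \<subseteq> G"
      unfolding G_def using M a meet_left by blast
    have "G \<inter> I = {}"
    proof -
      have False if "m \<in> M" "m \<sqinter> a \<sqsubseteq> z" "z \<in> I" for m z
        using no I(3)[of z "m \<sqinter> a"] that M(2) a(1) by auto
      then show ?thesis
        unfolding G_def by blast
    qed
    moreover have "z \<in> G" if "y \<in> G" "z \<in> carrier L" "y \<sqsubseteq> z" for y z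
    proof -
      obtain m where "m \<in> M" "m \<sqinter> a \<sqsubseteq> y" "y \<in> carrier L"
        using \<open>y \<in> G\<close> unfolding G_def by blast
      then show ?thesis
        unfolding G_def using that le_trans[of "m \<sqinter> a" y z] M(2) a(1) meet_closed by blast
    qed
    moreover have "y \<sqinter> z \<in> G" if yz: "y \<in> G" "z \<in> G" for y z
    proof -
      obtain m n where mn: "m \<in> M" "m \<sqinter> a \<sqsubseteq> y" "n \<in> M" "n \<sqinter> a \<sqsubseteq> z"
        "y \<in> carrier L" "z \<in> carrier L"
        using yz unfolding G_def by blast
      then have c: "m \<in> carrier L" "n \<in> carrier L"
        using M(2) by blast+
      have "(m \<sqinter> n) \<sqinter> a \<sqsubseteq> m \<sqinter> a" "(m \<sqinter> n) \<sqinter> a \<sqsubseteq> n \<sqinter> a"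
        using c a(1) by (meson le_trans meet_closed meet_le meet_left meet_right)+
      then have "(m \<sqinter> n) \<sqinter> a \<sqsubseteq> y \<sqinter> z"
        using mn c a(1) by (meson le_trans meet_closed meet_le)
      then show ?thesis
        unfolding G_def using mn meet by auto
    qed
    ultimately have "G \<in> Fs"
      unfolding Fs_def using MG M(1) by (auto simp: G_def)
    then have "G = M"
      using max MG by blast
    moreover have "a \<in> G"
    proof -
      obtain m where "m \<in> M"
        using F(2) M(1) by blast
      then show ?thesis
        unfolding G_def using a M(2) meet_right by blast
    qed
    ultimately show False
      using a by blast
  qed
  have prime: "a \<in> M \<or> b \<in> M" if ab: "a \<in> carrier L" "b \<in> carrier L" "a \<squnion> b \<in> M" for a b
  proof (rule ccontr)
    assume "\<not> ?thesis"
    then obtain m n where m: "m \<in> M" "m \<sqinter> a \<in> I" and n: "n \<in> M" "n \<sqinter> b \<in> I"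
      using hit ab by blast
    define k where "k = m \<sqinter> n"
    have c: "m \<in> carrier L" "n \<in> carrier L" and k: "k \<in> M" "k \<in> carrier L"
      using m n M(2) meet unfolding k_def by blast+
    have "k \<sqinter> a \<sqsubseteq> m \<sqinter> a" "k \<sqinter> b \<sqsubseteq> n \<sqinter> b"
      using c ab unfolding k_def by (meson le_trans meet_closed meet_le meet_left meet_right)+
    then have "k \<sqinter> a \<in> I" "k \<sqinter> b \<in> I"
      using I(3) m n k ab meet_closed by blast+
    then have "k \<sqinter> (a \<squnion> b) \<in> I"
      using I(4) meet_join_distrib k ab by simp
    moreover have "k \<sqinter> (a \<squnion> b) \<in> M"
      using meet k ab by blast
    ultimately show False
      using M(3) by blast
  qed
  have "M \<noteq> {}" "M \<noteq> carrier L"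
    using F(2) M I(1,2) by blast+
  then have "prime_filter L M"
    unfolding prime_filter_def using M(2) up meet prime by blast
  then show thesis
    using that M by blast
qed

lemma prime_filter_separates_elements:
  assumes ab: "a \<in> carrier L" "b \<in> carrier L" "\<not> a \<sqsubseteq> b"
  obtains x where "x \<in> priestley_points L" "a \<in> x" "b \<notin> x"
proof -
  obtain x where "prime_filter L x" "{z \<in> carrier L. a \<sqsubseteq> z} \<subseteq> x" "x \<inter> {z \<in> carrier L. z \<sqsubseteq> b} = {}"
  proof (rule prime_filter_separation)
    show "{z \<in> carrier L. a \<sqsubseteq> z} \<inter> {z \<in> carrier L. z \<sqsubseteq> b} = {}"
      using ab le_trans by blast
  qed (use ab in \<open>auto intro: le_trans meet_le join_le\<close>)
  then show thesis
    using that[of x] ab unfolding priestley_points_def by blast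
qed

section \<open>The representation of elements by sets of prime filters\<close>

lemma sigma_meet:
  assumes "a \<in> carrier L" "b \<in> carrier L"
  shows "sigma L (a \<sqinter> b) = sigma L a \<inter> sigma L b"
  using assms meet_left[OF assms] meet_right[OF assms]
  unfolding sigma_def priestley_points_def prime_filter_def by blast

lemma sigma_join:
  assumes "a \<in> carrier L" "b \<in> carrier L"
  shows "sigma L (a \<squnion> b) = sigma L a \<union> sigma L b"
  using assms join_left[OF assms] join_right[OF assms] join_closed[OF assms]
  unfolding sigma_def priestley_points_def prime_filter_def by blast

lemma sigma_top: "sigma L \<top> = priestley_points L"
proof -
  have "\<top> \<in> x" if x: "prime_filter L x" for x
  proof -
    obtain a where "a \<in> x" "a \<in> carrier L"
      using x unfolding prime_filter_def by blast
    then show ?thesis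
      using x top_closed top_higher unfolding prime_filter_def by blast
  qed
  then show ?thesis
    unfolding sigma_def priestley_points_def by blast
qed

lemma sigma_bottom: "sigma L \<bottom> = {}"
proof -
  have "\<bottom> \<notin> x" if "prime_filter L x" for x
    using that bottom_lower unfolding prime_filter_def by blast
  then show ?thesis
    unfolding sigma_def priestley_points_def by blast
qed

lemma sigma_subset_iff:
  assumes ab: "a \<in> carrier L" "b \<in> carrier L"
  shows "sigma L a \<subseteq> sigma L b \<longleftrightarrow> a \<sqsubseteq> b"
proof
  show "sigma L a \<subseteq> sigma L b" if "a \<sqsubseteq> b"
    using that ab unfolding sigma_def priestley_points_def prime_filter_def by blast
  show "a \<sqsubseteq> b" if "sigma L a \<subseteq> sigma L b"
  proof (rule ccontr)
    assume "\<not> a \<sqsubseteq> b"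
    then obtain x where "x \<in> priestley_points L" "a \<in> x" "b \<notin> x"
      using prime_filter_separates_elements ab by blast
    then show False
      using that unfolding sigma_def by blast
  qed
qed

lemma finite_Union_sigma:
  assumes "finite A" "A \<subseteq> carrier L"
  obtains s where "s \<in> carrier L" "sigma L s = \<Union> (sigma L ` A)"
proof -
  have "\<exists>s\<in>carrier L. sigma L s = \<Union> (sigma L ` A)"
    using assms
  proof (induction rule: finite_induct)
    case empty
    show ?case
      using sigma_bottom by auto
  next
    case (insert a A)
    then obtain s where "s \<in> carrier L" "sigma L s = \<Union> (sigma L ` A)"
      by auto
    then show ?case
      using insert.prems sigma_join[of a s] by (intro bexI[of _ "a \<squnion> s"]) auto
  qed
  then show thesis
    using that by blast
qed

lemma finite_Inter_sigma_in_point: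
  assumes x: "x \<in> priestley_points L" and "finite A" "A \<subseteq> x"
  obtains m where "m \<in> x" "sigma L m = priestley_points L \<inter> \<Inter> (sigma L ` A)"
proof -
  have xc: "x \<subseteq> carrier L"
    using x unfolding priestley_points_def prime_filter_def by blast
  have "\<exists>m\<in>x. sigma L m = priestley_points L \<inter> \<Inter> (sigma L ` A)"
    using assms(2,3)
  proof (induction rule: finite_induct)
    case empty
    have "\<top> \<in> x"
      using x sigma_top unfolding sigma_def by blast
    then show ?case
      using sigma_top by auto
  next
    case (insert a A)
    then obtain m where m: "m \<in> x" "sigma L m = priestley_points L \<inter> \<Inter> (sigma L ` A)"
      by auto
    then have "a \<sqinter> m \<in> x"
      using x insert.prems unfolding priestley_points_def prime_filter_def by blast
    moreover have "sigma L (a \<sqinter> m) = sigma L a \<inter> sigma L m"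
      using m insert.prems xc by (intro sigma_meet) auto
    ultimately show ?case
      using m by (intro bexI[of _ "a \<sqinter> m"]) auto
  qed
  then show thesis
    using that by blast
qed

section \<open>The topology of the Priestley space\<close>

lemma sigma_subset_points: "sigma L a \<subseteq> priestley_points L"
  unfolding sigma_def by blast

lemma openin_basic:
  assumes "a \<in> carrier L" "b \<in> carrier L"
  shows "openin (priestley_topology L) (sigma L a - sigma L b)"
proof -
  have "sigma L a - sigma L b = sigma L a \<inter> (priestley_points L - sigma L b)"
    using sigma_subset_points by blast
  then show ?thesis
    unfolding priestley_topology_def using assms by (intro topology_generated_by_Basis) blast
qed

lemma openin_sigma: "a \<in> carrier L \<Longrightarrow> openin (priestley_topology L) (sigma L a)"
  using openin_basic[of a \<bottom>] sigma_bottom by simp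

lemma openin_sigma_compl:
  "a \<in> carrier L \<Longrightarrow> openin (priestley_topology L) (priestley_points L - sigma L a)"
  using openin_basic[of \<top> a] sigma_top by simp

lemma closedin_sigma: "a \<in> carrier L \<Longrightarrow> closedin (priestley_topology L) (sigma L a)"
  using openin_sigma_compl sigma_subset_points topspace_priestley_topology
  by (simp add: closedin_def)

text \<open>The generating sets are closed under binary intersections, since \<open>\<sigma>\<close> turns meets and joins into
  intersections and unions.  They therefore form a base and not merely a subbase.\<close>

lemma basic_neighbourhood:
  assumes "openin (priestley_topology L) T" "x \<in> T"
  obtains a b where "a \<in> carrier L" "b \<in> carrier L" "x \<in> sigma L a - sigma L b"
    "sigma L a - sigma L b \<subseteq> T"
proof -
  let ?S = "{sigma L a \<inter> (priestley_points L - sigma L b) | a b. a \<in> carrier L \<and> b \<in> carrier L}"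
  have "generate_topology_on ?S T"
    using assms(1) unfolding priestley_topology_def by (rule openin_topology_generated_by)
  then have "\<exists>a\<in>carrier L. \<exists>b\<in>carrier L. x \<in> sigma L a - sigma L b \<and> sigma L a - sigma L b \<subseteq> T"
    using assms(2)
  proof (induction rule: generate_topology_on.induct)
    case (Int T U)
    then obtain a b c d where ab: "a \<in> carrier L" "b \<in> carrier L" "c \<in> carrier L" "d \<in> carrier L"
      and x: "x \<in> sigma L a - sigma L b" "x \<in> sigma L c - sigma L d"
      and sub: "sigma L a - sigma L b \<subseteq> T" "sigma L c - sigma L d \<subseteq> U"
      by blast
    have "sigma L (a \<sqinter> c) - sigma L (b \<squnion> d) =
        (sigma L a - sigma L b) \<inter> (sigma L c - sigma L d)"
      using ab by (auto simp: sigma_meet sigma_join)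
    then have "x \<in> sigma L (a \<sqinter> c) - sigma L (b \<squnion> d)"
      "sigma L (a \<sqinter> c) - sigma L (b \<squnion> d) \<subseteq> T \<inter> U"
      using x sub by auto
    then show ?case
      using ab by (rule_tac bexI[of _ "a \<sqinter> c"], rule_tac bexI[of _ "b \<squnion> d"]) auto
  next
    case (UN K)
    then show ?case
      by blast
  next
    case (Basis s)
    then obtain a b where "a \<in> carrier L" "b \<in> carrier L"
      "s = sigma L a \<inter> (priestley_points L - sigma L b)"
      by blast
    with Basis.prems show ?case
      using sigma_subset_points by (rule_tac bexI[of _ a], rule_tac bexI[of _ b]) auto
  qed simp
  then show thesis
    using that by blast
qed

text \<open>This is compactness for the subbase of the sets \<open>\<sigma>(a)\<close> and their complements.  If no finite
  parts of \<open>A\<close> and \<open>B\<close> sufficed, then \<open>B\<close> would generate a filter disjoint from the ideal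
  generated by \<open>A\<close>, and a prime filter separating the two would be an uncovered point.\<close>

lemma sigma_cover_finite:
  assumes A: "A \<subseteq> carrier L" and B: "B \<subseteq> carrier L"
    and cover: "priestley_points L \<inter> \<Inter> (sigma L ` B) \<subseteq> \<Union> (sigma L ` A)"
  obtains A' B' where "finite A'" "A' \<subseteq> A" "finite B'" "B' \<subseteq> B"
    "priestley_points L \<inter> \<Inter> (sigma L ` B') \<subseteq> \<Union> (sigma L ` A')"
proof -
  have "\<exists>A' B'. finite A' \<and> A' \<subseteq> A \<and> finite B' \<and> B' \<subseteq> B \<and>
    priestley_points L \<inter> \<Inter> (sigma L ` B') \<subseteq> \<Union> (sigma L ` A')"
  proof (rule ccontr)
    assume none: "\<not> ?thesis"
    have no: "\<not> priestley_points L \<inter> \<Inter> (sigma L ` B') \<subseteq> \<Union> (sigma L ` A')"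
      if "finite A'" "A' \<subseteq> A" "finite B'" "B' \<subseteq> B" for A' B'
      using none that by blast
    \<comment> \<open>Both the filter and the ideal are described through \<open>\<sigma>\<close>, which avoids finite meets and joins.\<close>
    define F where "F = {z \<in> carrier L. \<exists>B'. finite B' \<and> B' \<subseteq> B \<and>
      priestley_points L \<inter> \<Inter> (sigma L ` B') \<subseteq> sigma L z}"
    define I where "I = {z \<in> carrier L. \<exists>A'. finite A' \<and> A' \<subseteq> A \<and> sigma L z \<subseteq> \<Union> (sigma L ` A')}"
    obtain x where x: "prime_filter L x" "F \<subseteq> x" "x \<inter> I = {}"
    proof (rule prime_filter_separation)
      show "F \<subseteq> carrier L" "I \<subseteq> carrier L"
        unfolding F_def I_def by blast+
      have "\<top> \<in> F"
        unfolding F_def using sigma_top by auto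
      then show "F \<noteq> {}"
        by blast
      have "\<bottom> \<in> I"
        unfolding I_def using sigma_bottom by auto
      then show "I \<noteq> {}"
        by blast
      show "b \<in> F" if "a \<in> F" "b \<in> carrier L" "a \<sqsubseteq> b" for a b
      proof -
        have "sigma L a \<subseteq> sigma L b"
          using that sigma_subset_iff unfolding F_def by blast
        then show ?thesis
          using that unfolding F_def by blast
      qed
      show "a \<in> I" if "b \<in> I" "a \<in> carrier L" "a \<sqsubseteq> b" for a b
      proof -
        have "sigma L a \<subseteq> sigma L b"
          using that sigma_subset_iff unfolding I_def by blast
        then show ?thesis
          using that unfolding I_def by blast
      qed
      show "a \<sqinter> b \<in> F" if ab: "a \<in> F" "b \<in> F" for a b
      proof -
        obtain P Q where "finite P" "P \<subseteq> B" "priestley_points L \<inter> \<Inter> (sigma L ` P) \<subseteq> sigma L a"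
          "finite Q" "Q \<subseteq> B" "priestley_points L \<inter> \<Inter> (sigma L ` Q) \<subseteq> sigma L b"
          "a \<in> carrier L" "b \<in> carrier L"
          using ab unfolding F_def by blast
        then show ?thesis
          unfolding F_def by (auto simp: sigma_meet intro!: exI[of _ "P \<union> Q"])
      qed
      show "a \<squnion> b \<in> I" if ab: "a \<in> I" "b \<in> I" for a b
      proof -
        obtain P Q where "finite P" "P \<subseteq> A" "sigma L a \<subseteq> \<Union> (sigma L ` P)"
          "finite Q" "Q \<subseteq> A" "sigma L b \<subseteq> \<Union> (sigma L ` Q)"
          "a \<in> carrier L" "b \<in> carrier L"
          using ab unfolding I_def by blast
        then show ?thesis
          unfolding I_def by (auto simp: sigma_join intro!: exI[of _ "P \<union> Q"])
      qed
      show "F \<inter> I = {}"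
        unfolding F_def I_def using no by fast
    qed
    then have xp: "x \<in> priestley_points L"
      unfolding priestley_points_def by simp
    have "b \<in> F" if "b \<in> B" for b
      unfolding F_def using that B by (auto intro!: exI[of _ "{b}"])
    then have "x \<in> priestley_points L \<inter> \<Inter> (sigma L ` B)"
      using x xp unfolding sigma_def by blast
    then obtain a where a: "a \<in> A" "x \<in> sigma L a"
      using cover by blast
    then have "a \<in> I"
      unfolding I_def using A by (auto intro!: exI[of _ "{a}"])
    then show False
      using a x unfolding sigma_def by blast
  qed
  then show thesis
    using that by blast
qed

text \<open>Alexander's subbase theorem reduces the claim to the preceding lemma, once the topology is seen to be
  generated by the sets \<open>\<sigma>(a)\<close> together with their complements.\<close>

theorem compact_priestley_space: "compact_space (priestley_topology L)"
proof -
  let ?X = "priestley_points L"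
  let ?P = "sigma L ` carrier L" and ?N = "(\<lambda>b. ?X - sigma L b) ` carrier L"
  let ?T = "topology (arbitrary union_of (finite intersection_of (\<lambda>S. S \<in> ?P \<union> ?N) relative_to ?X))"
  have sub_open: "openin ?T S" if "S \<in> ?P \<union> ?N" for S
  proof -
    have "S \<subseteq> ?X"
      using that sigma_subset_points by blast
    then show ?thesis
      unfolding openin_subbase using that
      by (metis (no_types, lifting) arbitrary_union_of_inc finite_intersection_of_inc
          inf.absorb_iff2 relative_to_inc)
  qed
  show ?thesis
  proof (rule Alexander_subbase_alt)
    show "?X \<subseteq> \<Union> (?P \<union> ?N)"
      using sigma_top top_closed by blast
  next
    fix C
    assume C: "C \<subseteq> ?P \<union> ?N" and cover: "?X \<subseteq> \<Union> C"
    define A where "A = {a \<in> carrier L. sigma L a \<in> C}"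
    define B where "B = {b \<in> carrier L. ?X - sigma L b \<in> C}"
    have "?X \<inter> \<Inter> (sigma L ` B) \<subseteq> \<Union> (sigma L ` A)"
    proof
      fix x
      assume x: "x \<in> ?X \<inter> \<Inter> (sigma L ` B)"
      then obtain S where "S \<in> C" "x \<in> S"
        using cover by blast
      then show "x \<in> \<Union> (sigma L ` A)"
        using x C unfolding A_def B_def by blast
    qed
    then obtain A' B' where fin: "finite A'" "A' \<subseteq> A" "finite B'" "B' \<subseteq> B"
      and sub: "?X \<inter> \<Inter> (sigma L ` B') \<subseteq> \<Union> (sigma L ` A')"
      using sigma_cover_finite[of A B] unfolding A_def B_def by blast
    show "\<exists>C'. finite C' \<and> C' \<subseteq> C \<and> ?X \<subseteq> \<Union> C'"
    proof (intro exI conjI)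
      show "finite (sigma L ` A' \<union> (\<lambda>b. ?X - sigma L b) ` B')"
        using fin by blast
      show "sigma L ` A' \<union> (\<lambda>b. ?X - sigma L b) ` B' \<subseteq> C"
        using fin unfolding A_def B_def by blast
      show "?X \<subseteq> \<Union> (sigma L ` A' \<union> (\<lambda>b. ?X - sigma L b) ` B')"
      proof
        fix x
        assume x: "x \<in> ?X"
        show "x \<in> \<Union> (sigma L ` A' \<union> (\<lambda>b. ?X - sigma L b) ` B')"
        proof (cases "\<forall>b\<in>B'. x \<in> sigma L b")
          case True
          then have "x \<in> \<Union> (sigma L ` A')"
            using x sub by blast
          then show ?thesis
            by blast
        qed (use x in blast)
      qed
    qed
  next
    show "?T = priestley_topology L"
      unfolding topology_eq
    proof (intro allI iffI)
      fix S
      assume S: "openin ?T S"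
      have "openin (priestley_topology L) ?X"
        using openin_sigma[OF top_closed] sigma_top by simp
      from _ this S show "openin (priestley_topology L) S"
        by (rule minimal_topology_subbase) (auto simp: openin_sigma openin_sigma_compl)
    next
      fix S
      assume "openin (priestley_topology L) S"
      then have "generate_topology_on
          {sigma L a \<inter> (?X - sigma L b) | a b. a \<in> carrier L \<and> b \<in> carrier L} S"
        unfolding priestley_topology_def by (rule openin_topology_generated_by)
      then show "openin ?T S"
      proof (induction rule: generate_topology_on.induct)
        case (Basis s)
        then obtain a b where "a \<in> carrier L" "b \<in> carrier L" "s = sigma L a \<inter> (?X - sigma L b)"
          by blast
        then show ?case
          using openin_Int[OF sub_open[of "sigma L a"] sub_open[of "?X - sigma L b"]] by blast
      qed auto
    qed
  qed
qed

section \<open>Clopen upsets represent the elements of the frame\<close>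

lemma clopen_upset_sigma: "a \<in> carrier L \<Longrightarrow> clopen_upset L (sigma L a)"
  unfolding clopen_upset_def using openin_sigma closedin_sigma by (auto simp: sigma_def)

text \<open>For \<open>x \<in> U\<close>, each point outside \<open>U\<close> omits some element of \<open>x\<close>; by compactness of the
  complement of \<open>U\<close>, finitely many elements of \<open>x\<close> serve for all such points, and their meet
  \<open>m\<close> satisfies \<open>x \<in> \<sigma>(m) \<subseteq> U\<close>.  By compactness of \<open>U\<close>, finitely many of these
  \<open>\<sigma>(m)\<close> cover \<open>U\<close>, and their union is \<open>\<sigma>\<close> of a finite join.\<close>

lemma clopen_upset_is_sigma:
  assumes U: "clopen_upset L U"
  obtains a where "a \<in> carrier L" "U = sigma L a"
proof -
  have U_open: "openin (priestley_topology L) U" and U_closed: "closedin (priestley_topology L) U"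
    and up: "\<And>x y. \<lbrakk>x \<in> U; y \<in> priestley_points L; x \<subseteq> y\<rbrakk> \<Longrightarrow> y \<in> U"
    using U unfolding clopen_upset_def by blast+
  have UX: "U \<subseteq> priestley_points L"
    using openin_subset[OF U_open] topspace_priestley_topology by simp
  have cptU: "compactin (priestley_topology L) U"
    using closedin_compact_space compact_priestley_space U_closed by blast
  have "closedin (priestley_topology L) (priestley_points L - U)"
    using U_open topspace_priestley_topology by (metis openin_closedin_eq)
  then have cptC: "compactin (priestley_topology L) (priestley_points L - U)"
    using closedin_compact_space compact_priestley_space by blast
  have basic_nbhd: "\<exists>m\<in>carrier L. x \<in> sigma L m \<and> sigma L m \<subseteq> U" if xU: "x \<in> U" for x
  proof -
    have x: "x \<in> priestley_points L" and xc: "x \<subseteq> carrier L"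
      using xU UX unfolding priestley_points_def prime_filter_def by blast+
    have "priestley_points L - U \<subseteq> \<Union> ((\<lambda>a. priestley_points L - sigma L a) ` x)"
      using up[OF xU] unfolding sigma_def by blast
    moreover have "openin (priestley_topology L) S"
      if "S \<in> (\<lambda>a. priestley_points L - sigma L a) ` x" for S
      using that xc openin_sigma_compl by blast
    ultimately obtain \<F> where \<F>: "finite \<F>" "\<F> \<subseteq> (\<lambda>a. priestley_points L - sigma L a) ` x"
      "priestley_points L - U \<subseteq> \<Union> \<F>"
      using compactinD[OF cptC] by meson
    then obtain A where A: "finite A" "A \<subseteq> x"
      "priestley_points L - U \<subseteq> \<Union> ((\<lambda>a. priestley_points L - sigma L a) ` A)"
      using finite_subset_image[OF \<F>(1,2)] by blast
    then obtain m where m: "m \<in> x" "sigma L m = priestley_points L \<inter> \<Inter> (sigma L ` A)"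
      using finite_Inter_sigma_in_point[OF x] by blast
    have "sigma L m \<subseteq> U"
      using A(3) unfolding m(2) by blast
    moreover have "x \<in> sigma L m"
      using m(1) x unfolding sigma_def by blast
    ultimately show ?thesis
      using m xc by blast
  qed
  let ?M = "{m \<in> carrier L. sigma L m \<subseteq> U}"
  have "U \<subseteq> \<Union> (sigma L ` ?M)"
    using basic_nbhd by blast
  moreover have "openin (priestley_topology L) S" if "S \<in> sigma L ` ?M" for S
    using that openin_sigma by blast
  ultimately obtain \<F> where \<F>: "finite \<F>" "\<F> \<subseteq> sigma L ` ?M" "U \<subseteq> \<Union> \<F>"
    using compactinD[OF cptU] by meson
  obtain A where A: "A \<subseteq> ?M" "finite A" and \<F>_eq: "\<F> = sigma L ` A"
    using finite_subset_image[OF \<F>(1,2)] by blast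
  have "A \<subseteq> carrier L"
    using A by blast
  then obtain s where s: "s \<in> carrier L" "sigma L s = \<Union> (sigma L ` A)"
    using finite_Union_sigma[OF A(2)] by blast
  have "\<Union> (sigma L ` A) \<subseteq> U"
    using A by blast
  then have "U = sigma L s"
    using \<F>(3) unfolding s(2) \<F>_eq by (rule subset_antisym[rotated])
  then show thesis
    using that s(1) by blast
qed

lemma carrier_ClopUp: "carrier (ClopUp L) = sigma L ` carrier L"
  unfolding ClopUp_def using clopen_upset_sigma clopen_upset_is_sigma by fastforce

lemma sigma_iso: "complete_lattice_iso L (ClopUp L) (sigma L)"
proof -
  have "partial_order (ClopUp L)"
    unfolding ClopUp_def by unfold_locales auto
  moreover have "inj_on (sigma L) (carrier L)"
    by (rule inj_onI) (metis le_antisym order_refl sigma_subset_iff)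
  then have "bij_betw (sigma L) (carrier L) (carrier (ClopUp L))"
    unfolding bij_betw_def carrier_ClopUp by blast
  moreover have "sigma L a \<sqsubseteq>\<^bsub>ClopUp L\<^esub> sigma L b \<longleftrightarrow> a \<sqsubseteq> b" if "a \<in> carrier L" "b \<in> carrier L" for a b
    using sigma_subset_iff that by (simp add: ClopUp_def)
  ultimately show ?thesis
    by (intro complete_lattice_iso.intro complete_lattice_iso_axioms.intro complete_lattice_axioms)
qed

section \<open>The completely regular kernel\<close>

text \<open>A scale that witnesses that \<open>x\<close> is completely inside \<open>\<sigma>(a)\<close> starts at a clopen upset, so at
  some \<open>\<sigma>(c)\<close> containing \<open>x\<close>; it corresponds to a scale from \<open>c\<close> to \<open>a\<close>.\<close>

lemma creg_sigma:
  assumes a: "a \<in> carrier L"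
  shows "creg L (sigma L a) = \<Union> (sigma L ` {c \<in> carrier L. completely_below L c a})"
proof -
  interpret iso: complete_lattice_iso L "ClopUp L" "sigma L"
    by (rule sigma_iso)
  have "completely_inside L x (sigma L a) \<longleftrightarrow>
      (\<exists>c\<in>carrier L. completely_below L c a \<and> x \<in> sigma L c)" for x
  proof -
    have "V \<in> carrier (ClopUp L)" if VW: "completely_below (ClopUp L) V W" for V W
    proof -
      obtain d where "is_scale (ClopUp L) V W d"
        using VW unfolding completely_below_def by blast
      then have "d 0 = V" "\<forall>r\<in>{0..1}. d r \<in> carrier (ClopUp L)"
        unfolding is_scale_def by blast+
      then show ?thesis
        by force
    qed
    then have "completely_inside L x (sigma L a) \<longleftrightarrow>
        (\<exists>V\<in>carrier (ClopUp L). completely_below (ClopUp L) V (sigma L a) \<and> x \<in> V)"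
      unfolding completely_inside_def completely_below_def by blast
    then show ?thesis
      unfolding carrier_ClopUp using iso.completely_below_iff a by auto
  qed
  moreover have "sigma L c \<subseteq> sigma L a" if "c \<in> carrier L" "completely_below L c a" for c
    using that a scale_le sigma_subset_iff unfolding completely_below_def by blast
  ultimately show ?thesis
    unfolding creg_def by blast
qed

end

section \<open>Complete regularity and density of the kernels\<close>

theorem theorem5p22:
  fixes L :: "('a, 'b) gorder_scheme"
  assumes "frame L"
  shows "completely_regular L \<longleftrightarrow>
    (\<forall>U\<in>carrier (ClopUp L). priestley_topology L closure_of creg L U = U)"
proof -
  interpret frame L
    by (rule assms)
  show ?thesis
  proof
    assume reg: "completely_regular L"
    show "\<forall>U\<in>carrier (ClopUp L). priestley_topology L closure_of creg L U = U"
    proof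
      fix U
      assume "U \<in> carrier (ClopUp L)"
      then obtain a where a: "a \<in> carrier L" and U: "U = sigma L a"
        unfolding carrier_ClopUp by blast
      have "priestley_topology L closure_of creg L U \<subseteq> U"
        using closedin_sigma[OF a] unfolding U by (intro closure_of_minimal) (auto simp: creg_def)
      moreover have "x \<in> priestley_topology L closure_of creg L U" if x: "x \<in> U" for x
        unfolding in_closure_of
      proof (intro conjI allI impI)
        show "x \<in> topspace (priestley_topology L)"
          using x sigma_subset_points unfolding U topspace_priestley_topology by blast
        fix T
        assume "x \<in> T \<and> openin (priestley_topology L) T"
        then obtain b d where b: "b \<in> carrier L" and d: "d \<in> carrier L"
          and xbd: "x \<in> sigma L b - sigma L d" and T: "sigma L b - sigma L d \<subseteq> T"
          using basic_neighbourhood by metis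
        \<comment> \<open>Meeting with \<open>b\<close> is what places the kernel point found below inside the neighbourhood.\<close>
        have "x \<in> sigma L (a \<sqinter>\<^bsub>L\<^esub> b) - sigma L d"
          using x xbd a b sigma_meet unfolding U by blast
        then have "\<not> a \<sqinter>\<^bsub>L\<^esub> b \<sqsubseteq>\<^bsub>L\<^esub> d"
          using sigma_subset_iff[of "a \<sqinter>\<^bsub>L\<^esub> b" d] a b d by auto
        then obtain c where c: "c \<in> carrier L" "completely_below L c (a \<sqinter>\<^bsub>L\<^esub> b)"
          and cd: "\<not> c \<sqsubseteq>\<^bsub>L\<^esub> d"
          using reg[unfolded completely_regular_def, rule_format, OF meet_closed[OF a b] d] by blast
        obtain y where y: "y \<in> sigma L c" "y \<notin> sigma L d"
          using cd sigma_subset_iff[OF c(1) d] by blast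
        have "completely_below L c a" "completely_below L c b"
          using c completely_below_mono[of c "a \<sqinter>\<^bsub>L\<^esub> b"] meet_left meet_right a b by simp_all
        then have "y \<in> creg L (sigma L a)" "y \<in> creg L (sigma L b)"
          using y c creg_sigma a b by blast+
        then show "\<exists>y. y \<in> creg L U \<and> y \<in> T"
          using y T unfolding U by (auto simp: creg_def)
      qed
      ultimately show "priestley_topology L closure_of creg L U = U"
        by blast
    qed
  next
    assume dense: "\<forall>U\<in>carrier (ClopUp L). priestley_topology L closure_of creg L U = U"
    show "completely_regular L"
      unfolding completely_regular_def
    proof (intro ballI impI)
      fix a b
      assume a: "a \<in> carrier L" and b: "b \<in> carrier L" and "\<not> a \<sqsubseteq>\<^bsub>L\<^esub> b"
      then obtain x where x: "x \<in> sigma L a - sigma L b"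
        using sigma_subset_iff by blast
      then have "x \<in> priestley_topology L closure_of creg L (sigma L a)"
        using dense a unfolding carrier_ClopUp by blast
      then obtain y where y: "y \<in> creg L (sigma L a)" "y \<in> sigma L a - sigma L b"
        using x openin_basic[OF a b] unfolding in_closure_of by blast
      then obtain c where "c \<in> carrier L" "completely_below L c a" "y \<in> sigma L c"
        using creg_sigma[OF a] by blast
      moreover from this have "\<not> c \<sqsubseteq>\<^bsub>L\<^esub> b"
        using y sigma_subset_iff[of c b] b by blast
      ultimately show "\<exists>c\<in>carrier L. completely_below L c a \<and> \<not> c \<sqsubseteq>\<^bsub>L\<^esub> b"
        by blast
    qed
  qed
qed

end
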